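(* Let $f\in\mathcal{F}_L(\mathbb{R}^d)$, let $N\ge 1$, and let $y_0,\dots,y_N\in\mathbb{R}^d$ be the primary sequence generated by the algorithms OGM1 and OGM2 (run for $N$ iterations on $f$ from the initial point $x_0$, with $x_*\in X_*(f)$ and $\|x_0-x_*\|\le R$). Then for every $1\le i\le N$, $$f(y_i)-f(x_* )\;\le\;\frac{LR^2}{4t_{i-1}^2}\;\le\;\frac{LR^2}{(i+1)^2}.$$
   Context: Let $L>0$, $R>0$, $d\ge 1$. $\mathcal{F}_L(\mathbb{R}^d)$ denotes the class of convex, continuously differentiable functions $f:\mathbb{R}^d\to\mathbb{R}$ with $\|\nabla f(x)-\nabla f(y)\|\le L\|x-y\|$ for all $x,y\in\mathbb{R}^d$ (Euclidean norm), such that the optimal set $X_*(f)=\arg\min_{x\in\mathbb{R}^d} f(x)$ is nonempty and the given initial point $x_0$ and an optimal point $x_*\in X_*(f)$ satisfy $\|x_0-x_*\|\le R$. The sequence $(t_i)$ is defined by $t_0=1$, $t_{i+1}=\frac{1+\sqrt{1+4t_i^2}}{2}$ for $i\ge 0$. For given $N$, the numbers $\theta_0,\dots,\theta_N$ are defined by $\theta_0=1$ and, for $i=0,\dots,N-1$, $\theta_{i+1}=\frac{1+\sqrt{1+4\theta_i^2}}{2}$ if $i\le N-2$ and $\theta_{i+1}=\frac{1+\sqrt{1+8\theta_i^2}}{2}$ if $i=N-1$. OGM1: input $f\in\mathcal{F}_L(\mathbb{R}^d)$, $x_0\in\mathbb{R}^d$, $y_0=x_0$. For $i=0,\dots,N-1$: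 $$y_{i+1}=x_i-\tfrac1L\nabla f(x_i),\qquad x_{i+1}=y_{i+1}+\frac{\theta_i-1}{\theta_{i+1}}(y_{i+1}-y_i)+\frac{\theta_i}{\theta_{i+1}}(y_{i+1}-x_i).$$ OGM2: input $f\in\mathcal{F}_L(\mathbb{R}^d)$, $x_0\in\mathbb{R}^d$, $y_0=x_0$. For $i=0,\dots,N-1$: $$y_{i+1}=x_i-\tfrac1L\nabla f(x_i),\quad z_{i+1}=x_0-\tfrac1L\sum_{k=0}^i 2\theta_k\nabla f(x_k),\quad x_{i+1}=\Big(1-\frac1{\theta_{i+1}}\Big)y_{i+1}+\frac1{\theta_{i+1}}z_{i+1}.$$ OGM1 and OGM2 produce identical sequences $\{y_i\}$ (the primary sequence) and $\{x_i\}$ (the secondary sequence). *)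

theory Defs
  imports "HOL-Analysis.Analysis"
begin

definition grad :: "('a::real_inner \<Rightarrow> real) \<Rightarrow> 'a \<Rightarrow> 'a" where
  "grad f x = (THE D. GDERIV f x :> D)"

lemma grad_eqI:
  assumes "GDERIV f x :> D"
  shows "grad f x = D"
  unfolding grad_def
proof (rule the_equality)
  show "GDERIV f x :> D" by fact
next
  fix E assume "GDERIV f x :> E"
  with assms have "(\<lambda>h. inner h E) = (\<lambda>h. inner h D)"
    unfolding gderiv_def by (rule has_derivative_unique[rotated])
  then have "inner (E - D) E = inner (E - D) D"
    by (rule fun_cong)
  then have "inner (E - D) (E - D) = 0"
    by (simp add: inner_diff_right)
  then show "E = D" by simp
qed

definition minimizers :: "('a \<Rightarrow> real) \<Rightarrow> 'a set" where
  "minimizers f = {x. is_arg_min f (\<lambda>_. True) x}"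

text \<open>
  The class \<open>\<F>\<^sub>L\<close>. The requirement that the initial point lie within distance \<open>R\<close> of a
  minimizer involves the points as well as the function, so it is not part of this set.
\<close>

definition smooth_convex :: "real \<Rightarrow> ('a::real_inner \<Rightarrow> real) set" where
  "smooth_convex L =
     {f. convex_on UNIV f \<and>
         (\<forall>x. \<exists>D. GDERIV f x :> D) \<and>
         continuous_on UNIV (grad f) \<and>
         (\<forall>x y. norm (grad f x - grad f y) \<le> L * norm (x - y)) \<and>
         minimizers f \<noteq> {}}"

primrec t_seq :: "nat \<Rightarrow> real" where
  "t_seq 0 = 1"
| "t_seq (Suc i) = (1 + sqrt (1 + 4 * (t_seq i)\<^sup>2)) / 2"

text \<open>
  The condition \<open>i \<le> N - 2\<close> is written \<open>i + 2 \<le> N\<close>, because truncated subtraction would make it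
  hold for \<open>N = 1\<close>, \<open>i = 0\<close>. Only the values of \<open>theta N\<close> at \<open>0, \<dots>, N\<close> are meaningful.
\<close>

primrec theta :: "nat \<Rightarrow> nat \<Rightarrow> real" where
  "theta N 0 = 1"
| "theta N (Suc i) =
     (if i + 2 \<le> N then (1 + sqrt (1 + 4 * (theta N i)\<^sup>2)) / 2
      else (1 + sqrt (1 + 8 * (theta N i)\<^sup>2)) / 2)"

text \<open>
  The sequences \<open>x\<close> (secondary) and \<open>y\<close> (primary) form a run of \<open>N\<close> iterations from \<open>x0\<close>; their
  terms beyond index \<open>N\<close> are unconstrained.
\<close>

definition OGM1 ::
  "nat \<Rightarrow> real \<Rightarrow> ('a::real_inner \<Rightarrow> real) \<Rightarrow> 'a \<Rightarrow> (nat \<Rightarrow> 'a) \<Rightarrow> (nat \<Rightarrow> 'a) \<Rightarrow> bool" where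
  "OGM1 N L f x0 x y \<longleftrightarrow>
     x 0 = x0 \<and> y 0 = x0 \<and>
     (\<forall>i<N.
        y (i + 1) = x i - (1 / L) *\<^sub>R grad f (x i) \<and>
        x (i + 1) = y (i + 1)
          + ((theta N i - 1) / theta N (i + 1)) *\<^sub>R (y (i + 1) - y i)
          + (theta N i / theta N (i + 1)) *\<^sub>R (y (i + 1) - x i))"

definition OGM2 ::
  "nat \<Rightarrow> real \<Rightarrow> ('a::real_inner \<Rightarrow> real) \<Rightarrow> 'a \<Rightarrow> (nat \<Rightarrow> 'a) \<Rightarrow> (nat \<Rightarrow> 'a) \<Rightarrow> bool" where
  "OGM2 N L f x0 x y \<longleftrightarrow>
     x 0 = x0 \<and> y 0 = x0 \<and>
     (\<exists>z. \<forall>i<N.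
        y (i + 1) = x i - (1 / L) *\<^sub>R grad f (x i) \<and>
        z (i + 1) = x0 - (1 / L) *\<^sub>R (\<Sum>k=0..i. (2 * theta N k) *\<^sub>R grad f (x k)) \<and>
        x (i + 1) = (1 - 1 / theta N (i + 1)) *\<^sub>R y (i + 1)
          + (1 / theta N (i + 1)) *\<^sub>R z (i + 1))"

end

theory Submission
  imports Defs
begin

text \<open>
  For \<open>k < N\<close> the weight \<open>theta N k\<close> is \<open>t k\<close>, so the exceptional last weight never enters the
  bound on \<open>y\<^sub>1, \<dots>, y\<^sub>N\<close>. Writing \<open>g\<^sub>k\<close> for the gradient at \<open>x\<^sub>k\<close>, the potential
  \<open>2 t\<^sub>k\<^sup>2 (f x\<^sub>k - \<parallel>g\<^sub>k\<parallel>\<^sup>2 / (2 L) - f x\<^sub>*) + (L / 2) \<parallel>z\<^sub>k\<^sub>+\<^sub>1 - x\<^sub>*\<parallel>\<^sup>2\<close> does not increase: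
  this is the sum of the interpolation inequalities at the pairs \<open>(x\<^sub>k\<^sub>+\<^sub>1, x\<^sub>k)\<close> and
  \<open>(x\<^sub>k\<^sub>+\<^sub>1, x\<^sub>*)\<close> with weights \<open>2 t\<^sub>k\<^sup>2\<close> and \<open>2 t\<^sub>k\<^sub>+\<^sub>1\<close>. It starts below
  \<open>(L / 2) \<parallel>x\<^sub>0 - x\<^sub>*\<parallel>\<^sup>2\<close>, and the descent lemma bounds \<open>f y\<^sub>k\<^sub>+\<^sub>1\<close> by \<open>f x\<^sub>k - \<parallel>g\<^sub>k\<parallel>\<^sup>2 / (2 L)\<close>.
\<close>

section \<open>Inequalities for smooth convex functions\<close>

lemma smooth_convex_GDERIV:
  assumes "f \<in> smooth_convex L"
  shows "GDERIV f x :> grad f x"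
  using assms grad_eqI unfolding smooth_convex_def by fastforce

text \<open>Restricting to a line turns the tangent and descent inequalities below into one-variable
  calculus.\<close>

lemma smooth_convex_line_derivative:
  fixes f :: "'a::real_inner \<Rightarrow> real"
  assumes "f \<in> smooth_convex L"
  shows "((\<lambda>t. f (x + t *\<^sub>R h)) has_real_derivative inner h (grad f (x + t *\<^sub>R h))) (at t within S)"
proof -
  have f: "(f has_derivative (\<lambda>v. inner v (grad f (x + t *\<^sub>R h))))
      (at (x + t *\<^sub>R h) within (\<lambda>t. x + t *\<^sub>R h) ` S)"
    using smooth_convex_GDERIV[OF assms] unfolding gderiv_def by (rule has_derivative_at_withinI)
  have "((\<lambda>t. x + t *\<^sub>R h) has_derivative (\<lambda>s. s *\<^sub>R h)) (at t within S)"
    by (auto intro!: derivative_eq_intros)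
  from has_derivative_in_compose[OF this f] show ?thesis
    unfolding has_field_derivative_def by (simp add: mult_commute_abs)
qed

lemma smooth_convex_above_tangent:
  fixes f :: "'a::real_inner \<Rightarrow> real"
  assumes f: "f \<in> smooth_convex L"
  shows "f x + inner (grad f x) (w - x) \<le> f w"
proof -
  let ?\<phi> = "\<lambda>t::real. f (x + t *\<^sub>R (w - x))"
  have "convex_on UNIV ?\<phi>"
  proof (rule convex_onI)
    fix t a b :: real
    assume t: "0 < t" "t < 1"
    have "x + ((1 - t) *\<^sub>R a + t *\<^sub>R b) *\<^sub>R (w - x)
        = (1 - t) *\<^sub>R (x + a *\<^sub>R (w - x)) + t *\<^sub>R (x + b *\<^sub>R (w - x))"
      by (simp add: algebra_simps)
    moreover have "convex_on UNIV f" using f by (simp add: smooth_convex_def)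
    ultimately show "?\<phi> ((1 - t) *\<^sub>R a + t *\<^sub>R b) \<le> (1 - t) * ?\<phi> a + t * ?\<phi> b"
      using t by (simp add: convex_onD)
  qed simp
  from convex_on_imp_above_tangent[OF this _ _ _ smooth_convex_line_derivative[OF f, of x "w - x" 0 UNIV],
      of 1]
  show ?thesis by (simp add: inner_commute)
qed

text \<open>Along the segment from \<open>x\<close> to \<open>w\<close>, \<open>f\<close> minus the
  quadratic model is nonincreasing: Cauchy-Schwarz and the Lipschitz bound make its derivative
  nonpositive.\<close>

lemma smooth_convex_descent:
  fixes f :: "'a::real_inner \<Rightarrow> real"
  assumes f: "f \<in> smooth_convex L"
  shows "f w \<le> f x + inner (grad f x) (w - x) + L / 2 * (norm (w - x))\<^sup>2"
proof -
  define h where "h = w - x"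
  let ?\<psi> = "\<lambda>t::real. f (x + t *\<^sub>R h) - t * inner (grad f x) h - L / 2 * t\<^sup>2 * (norm h)\<^sup>2"
  have "?\<psi> 1 \<le> ?\<psi> 0"
  proof (rule DERIV_nonpos_imp_nonincreasing[of 0 1 ?\<psi>])
    fix t :: real assume t: "0 \<le> t"
    have "(?\<psi> has_real_derivative
        inner h (grad f (x + t *\<^sub>R h)) - inner (grad f x) h - L * t * (norm h)\<^sup>2) (at t)"
      by (auto intro!: derivative_eq_intros smooth_convex_line_derivative[OF f])
    moreover have "inner h (grad f (x + t *\<^sub>R h)) - inner (grad f x) h - L * t * (norm h)\<^sup>2 \<le> 0"
    proof -
      have "norm (grad f (x + t *\<^sub>R h) - grad f x) \<le> L * norm (x + t *\<^sub>R h - x)"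
        using f unfolding smooth_convex_def by blast
      note lipschitz = mult_left_mono[OF this norm_ge_zero[of h]]
      have "inner h (grad f (x + t *\<^sub>R h) - grad f x) \<le> norm h * norm (grad f (x + t *\<^sub>R h) - grad f x)"
        by (rule norm_cauchy_schwarz)
      also have "\<dots> \<le> norm h * (L * norm (x + t *\<^sub>R h - x))"
        by (rule lipschitz)
      also have "\<dots> = L * t * (norm h)\<^sup>2" using t by (simp add: power2_eq_square)
      finally show ?thesis by (simp add: inner_diff_right inner_commute)
    qed
    ultimately show "\<exists>D. (?\<psi> has_real_derivative D) (at t) \<and> D \<le> 0" by blast
  qed simp
  then show ?thesis by (simp add: h_def)
qed

lemma smooth_convex_gradient_step:
  fixes f :: "'a::real_inner \<Rightarrow> real"
  assumes "f \<in> smooth_convex L" and "L > 0"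
  shows "f (x - (1 / L) *\<^sub>R grad f x) \<le> f x - (norm (grad f x))\<^sup>2 / (2 * L)"
  using smooth_convex_descent[OF assms(1), of "x - (1 / L) *\<^sub>R grad f x" x] assms(2)
  by (simp add: power2_norm_eq_inner[symmetric] power_divide) (simp add: field_simps power2_eq_square)

text \<open>A gradient step from \<open>s\<close> cannot go below the minimum, yet it gains at least
  the squared gradient norm over \<open>2 * L\<close>.\<close>

lemma grad_minimizer_eq_0:
  fixes f :: "'a::real_inner \<Rightarrow> real"
  assumes "f \<in> smooth_convex L" and "L > 0" and "s \<in> minimizers f"
  shows "grad f s = 0"
proof -
  have "f s \<le> f (s - (1 / L) *\<^sub>R grad f s)"
    using assms(3) by (auto simp: minimizers_def is_arg_min_linorder)
  then have "(norm (grad f s))\<^sup>2 / (2 * L) \<le> 0"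
    using smooth_convex_gradient_step[OF assms(1,2), of s] by linarith
  then show ?thesis
    using assms(2) by (simp add: divide_le_0_iff)
qed

lemma smooth_convex_interpolation:
  fixes f :: "'a::real_inner \<Rightarrow> real"
  assumes f: "f \<in> smooth_convex L" and L: "L > 0"
  shows "f x + inner (grad f x) (y - x) + (norm (grad f x - grad f y))\<^sup>2 / (2 * L) \<le> f y"
proof -
  define d where "d = grad f x - grad f y"
  \<comment> \<open>This \<open>w\<close> maximizes the gap between the tangent of \<open>f\<close>
    at \<open>x\<close> and the quadratic upper model of \<open>f\<close> at \<open>y\<close>; the
    lower bound cannot exceed the upper one there.\<close>
  define w where "w = y + (1 / L) *\<^sub>R d"
  have "f x + inner (grad f x) (w - x) \<le> f y + inner (grad f y) (w - y) + L / 2 * (norm (w - y))\<^sup>2"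
    using smooth_convex_above_tangent[OF f, of x w] smooth_convex_descent[OF f, of w y] by linarith
  moreover have "inner (grad f x) (w - x) = inner (grad f x) (y - x) + inner (grad f x) d / L"
    by (simp add: w_def inner_add_right inner_diff_right)
  moreover have "inner (grad f y) (w - y) = inner (grad f y) d / L"
    by (simp add: w_def)
  moreover have "inner (grad f x) d / L - inner (grad f y) d / L = (norm d)\<^sup>2 / L"
    by (simp add: d_def power2_norm_eq_inner inner_diff_left diff_divide_distrib)
  moreover have "L / 2 * (norm (w - y))\<^sup>2 = (norm d)\<^sup>2 / L - (norm d)\<^sup>2 / (2 * L)"
    using L by (simp add: w_def field_simps power2_eq_square)
  ultimately show ?thesis unfolding d_def by linarith
qed

section \<open>The weights\<close>

text \<open>Since the square root is at least \<open>2 * t_seq k\<close>, every step adds at least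
  1/2.\<close>

lemma t_seq_ge: "t_seq k \<ge> (real k + 2) / 2"
proof (induction k)
  case (Suc k)
  have "2 * t_seq k \<le> sqrt (1 + 4 * (t_seq k)\<^sup>2)"
    by (rule real_le_rsqrt) (simp add: power_mult_distrib)
  with Suc show ?case by simp
qed simp

lemma t_seq_pos: "t_seq k > 0"
  by (rule less_le_trans[OF _ t_seq_ge]) simp

text \<open>The recursion picks the positive root of this quadratic; the potential argument needs
  the weights only through it and positivity.\<close>

lemma t_seq_Suc_quadratic: "(t_seq (Suc k))\<^sup>2 - t_seq (Suc k) = (t_seq k)\<^sup>2"
proof -
  have "(sqrt (1 + 4 * (t_seq k)\<^sup>2))\<^sup>2 = 1 + 4 * (t_seq k)\<^sup>2" by simp
  then show ?thesis by (simp add: power2_eq_square field_simps)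
qed

lemma theta_eq_t_seq: "k < N \<Longrightarrow> theta N k = t_seq k"
  by (induction k) auto

lemma theta_pos: "theta N k > 0"
  by (cases k) (auto intro: add_pos_nonneg)

section \<open>A common form of the two algorithms\<close>

text \<open>A closed form for the sequence \<open>z\<close> of \<open>OGM2\<close> that also makes
  sense for \<open>OGM1\<close>. The strict bound \<open>k<i\<close> gives the value
  \<open>x0\<close> at index 0.\<close>

definition ogm_z :: "nat \<Rightarrow> real \<Rightarrow> ('a::real_inner \<Rightarrow> real) \<Rightarrow> 'a \<Rightarrow> (nat \<Rightarrow> 'a) \<Rightarrow> nat \<Rightarrow> 'a" where
  "ogm_z N L f x0 x i = x0 - (1 / L) *\<^sub>R (\<Sum>k<i. (2 * theta N k) *\<^sub>R grad f (x k))"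

lemma ogm_z_Suc:
  "ogm_z N L f x0 x (Suc i) = ogm_z N L f x0 x i - (2 * theta N i / L) *\<^sub>R grad f (x i)"
  by (simp add: ogm_z_def algebra_simps)

lemma OGM2_secondary:
  assumes "OGM2 N L f x0 x y" and "i \<le> N"
  shows "theta N i *\<^sub>R x i = (theta N i - 1) *\<^sub>R y i + ogm_z N L f x0 x i"
proof (cases i)
  case 0
  then show ?thesis using assms by (simp add: OGM2_def ogm_z_def)
next
  case (Suc j)
  with assms have "x i = (1 - 1 / theta N i) *\<^sub>R y i + (1 / theta N i) *\<^sub>R ogm_z N L f x0 x i"
    by (auto simp: OGM2_def ogm_z_def lessThan_Suc_atMost atMost_atLeast0 simp del: theta.simps)
  then show ?thesis
    using theta_pos[of N i] by (simp add: scaleR_add_right right_diff_distrib)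
qed

lemma OGM1_secondary:
  fixes x y :: "nat \<Rightarrow> 'a::real_inner"
  assumes "OGM1 N L f x0 x y" and "i \<le> N"
  shows "theta N i *\<^sub>R x i = (theta N i - 1) *\<^sub>R y i + ogm_z N L f x0 x i"
  using assms(2)
proof (induction i)
  case 0
  then show ?case using assms by (simp add: OGM1_def ogm_z_def)
next
  case (Suc i)
  let ?a = "theta N i" and ?b = "theta N (Suc i)"
  have step: "y (Suc i) = x i - (1 / L) *\<^sub>R grad f (x i)"
      "x (Suc i) = y (Suc i) + ((?a - 1) / ?b) *\<^sub>R (y (Suc i) - y i) + (?a / ?b) *\<^sub>R (y (Suc i) - x i)"
    using assms(1) Suc.prems unfolding OGM1_def by auto
  have "?b *\<^sub>R x (Suc i)
      = ?b *\<^sub>R y (Suc i) + (?a - 1) *\<^sub>R (y (Suc i) - y i) + ?a *\<^sub>R (y (Suc i) - x i)"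
    unfolding step(2) using theta_pos[of N "Suc i"] by (simp add: scaleR_add_right del: theta.simps)
  \<comment> \<open>The momentum terms are regrouped so that the last bracket is
    \<open>ogm_z\<close> at \<open>i\<close> by the induction hypothesis, and the middle term is its
    increment.\<close>
  also have "\<dots> = (?b - 1) *\<^sub>R y (Suc i) + (2 * ?a) *\<^sub>R (y (Suc i) - x i)
      + (?a *\<^sub>R x i - (?a - 1) *\<^sub>R y i)"
  proof -
    have "(2 * ?a) *\<^sub>R v = ?a *\<^sub>R v + ?a *\<^sub>R v" for v :: 'a
      by (simp add: scaleR_left_distrib[symmetric])
    then show ?thesis by (simp add: algebra_simps del: theta.simps)
  qed
  also have "?a *\<^sub>R x i - (?a - 1) *\<^sub>R y i = ogm_z N L f x0 x i"
    using Suc by simp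
  also have "(2 * ?a) *\<^sub>R (y (Suc i) - x i) = - ((2 * ?a / L) *\<^sub>R grad f (x i))"
    by (simp add: step(1))
  finally show ?case by (simp add: ogm_z_Suc del: theta.simps)
qed

section \<open>The potential argument\<close>

text \<open>
  The case \<open>s = 0\<close>, \<open>t = 1\<close> gives the initial bound.
\<close>

lemma potential_step:
  fixes f :: "'a::real_inner \<Rightarrow> real"
  assumes f: "f \<in> smooth_convex L" and L: "L > 0" and xstar: "xstar \<in> minimizers f"
    and t: "t > 0" and weights: "t\<^sup>2 - t = s\<^sup>2"
    and x': "t *\<^sub>R x' = (t - 1) *\<^sub>R (x - (1 / L) *\<^sub>R grad f x) + z"
    and z': "z' = z - (2 * t / L) *\<^sub>R grad f x'"
  shows "2 * t\<^sup>2 * (f x' - (norm (grad f x'))\<^sup>2 / (2 * L) - f xstar) + L / 2 * (norm (z' - xstar))\<^sup>2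
    \<le> 2 * s\<^sup>2 * (f x - (norm (grad f x))\<^sup>2 / (2 * L) - f xstar) + L / 2 * (norm (z - xstar))\<^sup>2"
proof -
  define y where "y = x - (1 / L) *\<^sub>R grad f x"
  define g where "g = grad f x'"
  define G where "G = (norm g)\<^sup>2"
  define u where "u = f x - (norm (grad f x))\<^sup>2 / (2 * L) - f xstar"
  define u' where "u' = f x' - G / (2 * L) - f xstar"
  have GL: "G / L = 2 * (G / (2 * L))" by simp
  have "f x' + inner g (xstar - x') + G / (2 * L) \<le> f xstar"
    using smooth_convex_interpolation[OF f L, of x' xstar] grad_minimizer_eq_0[OF f L xstar]
    by (simp add: g_def G_def)
  then have star: "u' \<le> inner g (x' - xstar) - G / L"
    unfolding u'_def inner_diff_right GL by linarith
  have "f x' + inner g (x - x') + (norm (g - grad f x))\<^sup>2 / (2 * L) \<le> f x"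
    using smooth_convex_interpolation[OF f L, of x' x] by (simp add: g_def)
  moreover have "(norm (g - grad f x))\<^sup>2 = G - 2 * inner g (grad f x) + (norm (grad f x))\<^sup>2"
    by (simp add: G_def power2_norm_eq_inner inner_diff_left inner_diff_right inner_commute)
  then have "(norm (g - grad f x))\<^sup>2 / (2 * L)
      = G / (2 * L) - inner g (grad f x) / L + (norm (grad f x))\<^sup>2 / (2 * L)"
    by (simp add: add_divide_distrib diff_divide_distrib)
  moreover have "inner g (x' - y) = inner g x' - inner g x + inner g (grad f x) / L"
    by (simp add: y_def inner_diff_right)
  ultimately have prev: "u' \<le> u + inner g (x' - y) - G / L"
    unfolding u'_def u_def inner_diff_right GL by linarith
  \<comment> \<open>With \<open>s\<^sup>2 = t * (t - 1)\<close> and the equation for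
    \<open>x'\<close>, the displacements in \<open>prev\<close> and \<open>star\<close> add up to a
    multiple of \<open>z - xstar\<close>, free of \<open>x'\<close> and \<open>y\<close>.\<close>
  have "s\<^sup>2 *\<^sub>R (x' - y) + t *\<^sub>R (x' - xstar) = (t - 1) *\<^sub>R (t *\<^sub>R x' - t *\<^sub>R y) + t *\<^sub>R (x' - xstar)"
    unfolding weights[symmetric] unfolding power2_eq_square by (simp add: algebra_simps)
  also have "\<dots> = (t - 1) *\<^sub>R (z - y) + (t *\<^sub>R x' - t *\<^sub>R xstar)"
    by (simp add: x' y_def[symmetric] algebra_simps)
  also have "\<dots> = t *\<^sub>R (z - xstar)"
    by (simp add: x' y_def[symmetric] algebra_simps)
  finally have "inner g (s\<^sup>2 *\<^sub>R (x' - y) + t *\<^sub>R (x' - xstar)) = t * inner g (z - xstar)"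
    by simp
  then have comb: "s\<^sup>2 * inner g (x' - y) + t * inner g (x' - xstar) = t * inner g (z - xstar)"
    by (simp add: inner_add_right)
  \<comment> \<open>Here \<open>prev\<close> is weighted by \<open>s\<^sup>2\<close> and
    \<open>star\<close> by \<open>t\<close>; these weights sum to \<open>t\<^sup>2\<close>.\<close>
  have "s\<^sup>2 * u' + t * u'
      \<le> s\<^sup>2 * (u + inner g (x' - y) - G / L) + t * (inner g (x' - xstar) - G / L)"
    using star prev t by (intro add_mono mult_left_mono) auto
  also have "\<dots> = s\<^sup>2 * u + t * inner g (z - xstar) - t\<^sup>2 * (G / L)"
    using comb weights by algebra
  finally have "t\<^sup>2 * u' \<le> s\<^sup>2 * u + t * inner g (z - xstar) - t\<^sup>2 * (G / L)"
    unfolding distrib_right[symmetric] weights[symmetric] by simp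
  moreover have "(norm (z' - xstar))\<^sup>2
      = (norm (z - xstar))\<^sup>2 - 4 * t / L * inner g (z - xstar) + (2 * t / L)\<^sup>2 * G"
  proof -
    have "z' - xstar = (z - xstar) - (2 * t / L) *\<^sub>R g" by (simp add: z' g_def)
    moreover have "(norm (a - c *\<^sub>R g))\<^sup>2 = (norm a)\<^sup>2 - 2 * c * inner g a + c\<^sup>2 * G" for a c
      by (simp only: G_def power2_norm_eq_inner)
        (simp add: inner_diff_left inner_diff_right inner_commute power2_eq_square)
    ultimately show ?thesis by (simp only:)
  qed
  \<comment> \<open>The step length \<open>2 * t / L\<close> makes the two new terms cancel against
    twice the bound on \<open>t\<^sup>2 * u'\<close>.\<close>
  then have "L / 2 * (norm (z' - xstar))\<^sup>2
      = L / 2 * (norm (z - xstar))\<^sup>2 - 2 * t * inner g (z - xstar) + 2 * t\<^sup>2 * (G / L)"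
  proof -
    have "L / 2 * (4 * t / L * inner g (z - xstar)) = 2 * t * inner g (z - xstar)"
      using L by simp
    moreover have "L / 2 * ((2 * t / L)\<^sup>2 * G) = 2 * t\<^sup>2 * (G / L)"
      using L by (simp add: power2_eq_square)
    ultimately show ?thesis
      by (simp only: \<open>(norm (z' - xstar))\<^sup>2 = _\<close> distrib_left right_diff_distrib)
  qed
  ultimately show ?thesis
    unfolding u_def u'_def G_def g_def by linarith
qed

text \<open>The hypotheses on \<open>x\<close> and \<open>y\<close> are what both algorithms share,
  so one induction serves both.\<close>

lemma ogm_potential_le:
  fixes f :: "'a::real_inner \<Rightarrow> real"
  assumes f: "f \<in> smooth_convex L" and L: "L > 0" and xstar: "xstar \<in> minimizers f"
    and x_0: "x 0 = x0"
    and y_Suc: "\<And>i. i < N \<Longrightarrow> y (Suc i) = x i - (1 / L) *\<^sub>R grad f (x i)"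
    and x_eq: "\<And>i. i \<le> N \<Longrightarrow> theta N i *\<^sub>R x i = (theta N i - 1) *\<^sub>R y i + ogm_z N L f x0 x i"
    and "k < N"
  shows "2 * (t_seq k)\<^sup>2 * (f (x k) - (norm (grad f (x k)))\<^sup>2 / (2 * L) - f xstar)
      + L / 2 * (norm (ogm_z N L f x0 x (Suc k) - xstar))\<^sup>2
    \<le> L / 2 * (norm (x0 - xstar))\<^sup>2"
  using \<open>k < N\<close>
proof (induction k)
  case 0
  have "ogm_z N L f x0 x (Suc 0) = x0 - (2 * 1 / L) *\<^sub>R grad f (x 0)"
    by (simp add: ogm_z_def)
  \<comment> \<open>For \<open>t = 1\<close> the coefficient \<open>t - 1\<close> vanishes, so any
    previous point would do; \<open>x 0\<close> fills the slot.\<close>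
  from potential_step[OF f L xstar _ _ _ this, of 0 "x 0"] show ?case
    by (simp add: x_0)
next
  case (Suc k)
  have *: "t_seq (Suc k) *\<^sub>R x (Suc k)
      = (t_seq (Suc k) - 1) *\<^sub>R (x k - (1 / L) *\<^sub>R grad f (x k)) + ogm_z N L f x0 x (Suc k)"
    using x_eq[of "Suc k"] Suc.prems by (simp only: theta_eq_t_seq y_Suc less_imp_le Suc_lessD)
  have "ogm_z N L f x0 x (Suc (Suc k))
      = ogm_z N L f x0 x (Suc k) - (2 * t_seq (Suc k) / L) *\<^sub>R grad f (x (Suc k))"
    using ogm_z_Suc[of N L f x0 x "Suc k"] Suc.prems by (simp only: theta_eq_t_seq)
  from potential_step[OF f L xstar t_seq_pos t_seq_Suc_quadratic * this] Suc show ?case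
    by (meson Suc_lessD order_trans)
qed

theorem theorem3p1:
  fixes f :: "real ^ 'n \<Rightarrow> real"
    and L R :: real
    and N :: nat
    and x0 xstar :: "real ^ 'n"
    and x y :: "nat \<Rightarrow> real ^ 'n"
  assumes "L > 0" and "R > 0" and "N \<ge> 1"
    and "f \<in> smooth_convex L"
    and "xstar \<in> minimizers f"
    and "norm (x0 - xstar) \<le> R"
    and "OGM1 N L f x0 x y \<or> OGM2 N L f x0 x y"
  shows "\<forall>i. 1 \<le> i \<and> i \<le> N \<longrightarrow>
           f (y i) - f xstar \<le> L * R\<^sup>2 / (4 * (t_seq (i - 1))\<^sup>2) \<and>
           L * R\<^sup>2 / (4 * (t_seq (i - 1))\<^sup>2) \<le> L * R\<^sup>2 / (real i + 1)\<^sup>2"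
proof (intro allI impI)
  fix i assume "1 \<le> i \<and> i \<le> N"
  then obtain k where i: "i = Suc k" and k: "k < N" by (cases i) auto
  have x_0: "x 0 = x0"
    using assms(7) by (auto simp: OGM1_def OGM2_def)
  have y_Suc: "y (Suc j) = x j - (1 / L) *\<^sub>R grad f (x j)" if "j < N" for j
    using assms(7) that by (auto simp: OGM1_def OGM2_def)
  have x_eq: "theta N j *\<^sub>R x j = (theta N j - 1) *\<^sub>R y j + ogm_z N L f x0 x j" if "j \<le> N" for j
    using assms(7) OGM1_secondary OGM2_secondary that by blast
  let ?u = "f (x k) - (norm (grad f (x k)))\<^sup>2 / (2 * L) - f xstar"
  have "0 \<le> L / 2 * (norm (ogm_z N L f x0 x (Suc k) - xstar))\<^sup>2"
    using \<open>L > 0\<close> by simp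
  then have "2 * (t_seq k)\<^sup>2 * ?u \<le> L / 2 * (norm (x0 - xstar))\<^sup>2"
    using ogm_potential_le[OF assms(4,1,5) x_0 y_Suc x_eq k] by linarith
  also have "\<dots> \<le> L / 2 * R\<^sup>2"
    using assms(1,6) by (intro mult_left_mono power_mono) auto
  finally have "?u \<le> L * R\<^sup>2 / (4 * (t_seq k)\<^sup>2)"
    using t_seq_pos[of k] by (simp add: field_simps)
  moreover have "f (y i) - f xstar \<le> ?u"
    using smooth_convex_gradient_step[OF assms(4,1), of "x k"] by (simp add: i y_Suc[OF k])
  moreover have "L * R\<^sup>2 / (4 * (t_seq k)\<^sup>2) \<le> L * R\<^sup>2 / (real i + 1)\<^sup>2"
  proof (rule divide_left_mono)
    \<comment> \<open>Because \<open>i = Suc k\<close>, the bound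
      \<open>2 * t_seq k \<ge> k + 2\<close> reads \<open>i + 1\<close>.\<close>
    have "(real i + 1)\<^sup>2 \<le> (2 * t_seq k)\<^sup>2"
      using t_seq_ge[of k] by (intro power_mono) (auto simp: i)
    then show "(real i + 1)\<^sup>2 \<le> 4 * (t_seq k)\<^sup>2" by (simp add: power_mult_distrib)
  qed (use \<open>L > 0\<close> t_seq_pos[of k] in \<open>auto intro!: mult_pos_pos\<close>)
  ultimately show "f (y i) - f xstar \<le> L * R\<^sup>2 / (4 * (t_seq (i - 1))\<^sup>2) \<and>
      L * R\<^sup>2 / (4 * (t_seq (i - 1))\<^sup>2) \<le> L * R\<^sup>2 / (real i + 1)\<^sup>2"
    by (simp add: i)
qed

end
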